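(* Let $n \in \mathbb{N}$ and let $p$ be a real number with $\frac{1}{n} \le p < 1$. Let $X$ be a binomially distributed random variable with parameters $n$ and $p$. Let $k = \lfloor np \rfloor$. Then $$\Pr[X > E[X]] > \frac{1}{2} - \sqrt{\frac{n}{2\pi k (n-k)}}.$$
   Context: $\mathbb{N} = \{1, 2, \dots\}$. A random variable $X$ is binomially distributed with parameters $n$ and $p$ if $\Pr[X=i] = \binom{n}{i} p^i (1-p)^{n-i}$ for all $i \in \{0,1,\dots,n\}$; then $E[X] = np$. *)

theory Defs
  imports "HOL-Probability.Probability"
begin

text \<open>
  The \<open>n + 1\<close> point probabilities sum to \<open>1\<close>, so on a probability space they determine the
  distribution of \<open>X\<close>; nothing has to be said about values outside \<open>{0..n}\<close>.
\<close>

definition binomially_distributed :: "'a measure \<Rightarrow> ('a \<Rightarrow> real) \<Rightarrow> nat \<Rightarrow> real \<Rightarrow> bool" where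
  "binomially_distributed M X n p \<longleftrightarrow>
     X \<in> borel_measurable M \<and>
     (\<forall>i\<in>{0..n}. \<P>(\<omega> in M. X \<omega> = real i) = real (n choose i) * p ^ i * (1 - p) ^ (n - i))"

end

theory Submission imports Defs begin

text \<open>
  Write \<open>Bernstein n i x\<close> for the binomial weight at \<open>i\<close> and \<open>T(j, x)\<close> for its tail over \<open>i \<ge> j\<close>.
  Since \<open>k \<le> n p < k + 1\<close>, the probability in question is at least \<open>T(k + 1, p)\<close>. Tails grow
  with the success probability, so lowering \<open>p\<close> to \<open>x = k / n\<close>, where the mean is exactly the integer
  \<open>k\<close>, only makes the claim harder. There

    \<open>T(k + 1, x) = T(k, x) - Bernstein n k x > 1 / 2 - sqrt (n / (2 \<pi> k (n - k)))\<close>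

  by two facts of different nature.

  The first is that an integer mean is a median, here \<open>T(k, x) > 1 / 2\<close>
  (\<open>binomial_tail_at_mean_gt_half\<close>). It is proved by reflecting the distribution at \<open>k - 1/2\<close>: let
  \<open>D j\<close> be the weight at \<open>k + j\<close> minus the weight at \<open>k - 1 - j\<close>. The claim is that the sum of the
  \<open>D j\<close> is positive. What is known for free is that the sum of \<open>(j + 1/2) D j\<close> is positive, since it is
  the mean minus \<open>k - 1/2\<close>. The sequence \<open>D\<close> starts positive and changes sign at most once, so the
  increasing factors \<open>j + 1/2\<close> favour the negative part; dropping them preserves positivity.
  The single change of sign comes from the quotient of the two weights, which is unimodal in \<open>j\<close>.

  The second is Stirling's formula with monotone error: \<open>n! = sqrt n (n / e)^n exp(s n)\<close> where \<open>s\<close>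
  decreases to \<open>ln (2 \<pi>) / 2\<close>. In \<open>Bernstein n k x\<close> all powers cancel and there remains
  \<open>sqrt (n / (k (n - k))) exp(s n - s k - s (n - k))\<close>, where \<open>s n \<le> s k\<close> and
  \<open>s (n - k) \<ge> ln (2 \<pi>) / 2\<close> (\<open>Bernstein_at_mean_le\<close>).
\<close>

section \<open>Stirling's formula with a decreasing error term\<close>

text \<open>
  The function \<open>s\<close> above: \<open>fact n = sqrt n * (n / e)^n * exp (stirling_rem n)\<close> for \<open>n \<ge> 1\<close>.
\<close>

definition stirling_rem :: "nat \<Rightarrow> real" where
  "stirling_rem n = ln (fact n) - ((real n + 1 / 2) * ln (real n) - real n)"

lemma stirling_rem_diff:
  assumes "n \<ge> 1"
  shows "stirling_rem n - stirling_rem (Suc n) =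
           (real n + 1 / 2) * (ln (real (Suc n)) - ln (real n)) - 1"
proof -
  have "ln (fact (Suc n) :: real) = ln (real (Suc n)) + ln (fact n)"
    by (simp add: ln_mult del: of_nat_Suc)
  then show ?thesis
    by (simp add: stirling_rem_def algebra_simps)
qed

text \<open>
  By the midpoint rule for the convex function \<open>1 / t\<close>, the area \<open>ln (n + 1) - ln n\<close> below it is at
  least \<open>1 / (n + 1/2)\<close>; so the exponent \<open>n + 1/2\<close> is just large enough for the error to decrease.
\<close>

lemma stirling_rem_Suc_le:
  assumes "n \<ge> 1"
  shows "stirling_rem (Suc n) \<le> stirling_rem n"
proof -
  have "2 * (real (Suc n) - real n) / (real n + real (Suc n)) \<le> ln (real (Suc n)) - ln (real n)"
    using assms by (intro ln_inverse_approx_ge) auto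
  then have "1 / (real n + 1 / 2) \<le> ln (real (Suc n)) - ln (real n)"
    by (simp add: field_simps)
  then have "1 \<le> (real n + 1 / 2) * (ln (real (Suc n)) - ln (real n))"
    by (simp add: pos_divide_le_eq mult.commute)
  then show ?thesis
    using stirling_rem_diff[OF assms] by linarith
qed

text \<open>
  The trapezoidal rule bounds the same area from above. Subtracting \<open>1 / (4 n)\<close> therefore reverses
  the monotonicity, which keeps \<open>stirling_rem\<close> bounded below.
\<close>

lemma stirling_rem_lower_Suc_ge:
  assumes "n \<ge> 1"
  shows "stirling_rem n - 1 / (4 * real n) \<le> stirling_rem (Suc n) - 1 / (4 * real (Suc n))"
proof -
  have "ln (real n + 1) - ln (real n) \<le> 1 * (inverse (real n) + inverse (real n + 1)) / 2"
    using assms by (intro ln_inverse_approx_le) auto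
  then have "(real n + 1 / 2) * (ln (real (Suc n)) - ln (real n))
      \<le> (real n + 1 / 2) * ((inverse (real n) + inverse (real n + 1)) / 2)"
    by (intro mult_left_mono) (auto simp: add.commute)
  also have "\<dots> = 1 + (1 / (4 * real n) - 1 / (4 * real (Suc n)))"
    using assms by (simp add: divide_simps) (simp add: algebra_simps)
  finally show ?thesis
    using stirling_rem_diff[OF assms] by linarith
qed

lemma stirling_rem_convergent: "convergent (\<lambda>n. stirling_rem (Suc n))"
proof -
  have dec: "decseq (\<lambda>n. stirling_rem (Suc n))"
    by (intro decseq_SucI stirling_rem_Suc_le) auto
  have inc: "incseq (\<lambda>n. stirling_rem (Suc n) - 1 / (4 * real (Suc n)))"
    by (intro incseq_SucI stirling_rem_lower_Suc_ge) auto
  have "stirling_rem 1 - 1 / 4 \<le> stirling_rem (Suc n)" for n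
  proof -
    have "stirling_rem 1 - 1 / 4 \<le> stirling_rem (Suc n) - 1 / (4 * real (Suc n))"
      using incseqD[OF inc, of 0 n] by simp
    also have "\<dots> \<le> stirling_rem (Suc n)"
      by simp
    finally show ?thesis .
  qed
  then obtain L where "(\<lambda>n. stirling_rem (Suc n)) \<longlonglongrightarrow> L"
    using decseq_convergent[OF dec] by blast
  then show ?thesis
    by (auto simp: convergent_def)
qed

lemma wallis_product_closed_form:
  "(\<Prod>k=1..n. (4 * real k ^ 2) / (4 * real k ^ 2 - 1)) =
     (4 ^ n * fact n ^ 2 / fact (2 * n)) ^ 2 / (2 * real n + 1)"
proof (induction n)
  case (Suc n)
  have f: "fact (2 * Suc n) = (2 * real n + 2) * (2 * real n + 1) * fact (2 * n)"
    by (simp add: algebra_simps)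
  have nz: "2 * real n + 1 \<noteq> 0" "2 * real n + 2 \<noteq> 0" "2 * real n + 3 \<noteq> 0"
    by linarith+
  have s: "4 * real (Suc n) ^ 2 - 1 = (2 * real n + 1) * (2 * real n + 3)"
    "2 * real (Suc n) + 1 = 2 * real n + 3"
    "fact (Suc n) = (real n + 1) * fact n"
    by (simp_all add: algebra_simps power2_eq_square)
  have "(\<Prod>k=1..Suc n. (4 * real k ^ 2) / (4 * real k ^ 2 - 1)) =
      (\<Prod>k=1..n. (4 * real k ^ 2) / (4 * real k ^ 2 - 1))
        * (4 * real (Suc n) ^ 2 / (4 * real (Suc n) ^ 2 - 1))"
    by (subst prod.nat_ivl_Suc') (simp_all add: mult.commute del: of_nat_Suc)
  also have "\<dots> = (4 ^ n * fact n ^ 2 / fact (2 * n)) ^ 2 / (2 * real n + 1)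
        * (4 * (real n + 1) ^ 2 / ((2 * real n + 1) * (2 * real n + 3)))"
    unfolding Suc.IH s(1) by (simp add: add.commute)
  also have "\<dots> = (4 ^ Suc n * ((real n + 1) * fact n) ^ 2 /
      ((2 * real n + 2) * (2 * real n + 1) * fact (2 * n))) ^ 2 / (2 * real n + 3)"
    using nz by (simp add: divide_simps power2_eq_square) (simp add: algebra_simps)
  finally show ?case
    unfolding f s .
qed simp

text \<open>
  The combination \<open>2 s(n) - s(2 n)\<close> has the same limit as \<open>s\<close>, and in it the powers of \<open>n / e\<close>
  disappear; what is left is the quotient of \<open>4^n\<close> by the central binomial coefficient, whose square is
  \<open>2 n + 1\<close> times the \<open>n\<close>-th partial product of Wallis. This is how \<open>\<pi>\<close> enters.
\<close>

lemma two_stirling_rem_minus_double: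
  assumes "n \<ge> 1"
  shows "2 * stirling_rem n - stirling_rem (2 * n) =
           ln ((\<Prod>k=1..n. (4 * real k ^ 2) / (4 * real k ^ 2 - 1)) * (4 + 2 / real n)) / 2"
proof -
  define q :: real where "q = 4 ^ n * fact n ^ 2 / fact (2 * n)"
  have q: "q > 0"
    by (simp add: q_def)
  have n: "real n > 0"
    using assms by simp
  have lnq: "ln q = real n * ln 4 + 2 * ln (fact n) - ln (fact (2 * n))"
    by (simp add: q_def ln_mult ln_div ln_realpow)
  have ln4: "ln (4::real) = 2 * ln 2"
    using ln_realpow[of 2 2] by simp
  have "(\<Prod>k=1..n. (4 * real k ^ 2) / (4 * real k ^ 2 - 1)) * (4 + 2 / real n) = q ^ 2 * (2 / real n)"
  proof -
    have 4: "4 + 2 / real n = (2 * real n + 1) * (2 / real n)"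
      using n by (simp add: field_simps)
    have cancel: "a / d * (d * t) = a * t" if "d > 0" for a d t :: real
      using that by simp
    show ?thesis
      unfolding wallis_product_closed_form q_def[symmetric] 4 by (rule cancel) linarith
  qed
  then have "ln ((\<Prod>k=1..n. (4 * real k ^ 2) / (4 * real k ^ 2 - 1)) * (4 + 2 / real n))
      = 2 * ln q + ln 2 - ln (real n)"
    using q n by (simp add: ln_mult ln_div ln_realpow)
  moreover have "ln (real (2 * n)) = ln 2 + ln (real n)"
    using n by (simp add: ln_mult)
  ultimately show ?thesis
    by (simp add: stirling_rem_def lnq ln4 algebra_simps)
qed

lemma stirling_rem_LIMSEQ: "(\<lambda>n. stirling_rem (Suc n)) \<longlonglongrightarrow> ln (2 * pi) / 2"
proof -
  obtain L where L: "(\<lambda>n. stirling_rem (Suc n)) \<longlonglongrightarrow> L"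
    using stirling_rem_convergent by (auto simp: convergent_def)
  have L': "stirling_rem \<longlonglongrightarrow> L"
    using L by (rule LIMSEQ_imp_Suc)
  have "(\<lambda>n. stirling_rem (2 * n)) \<longlonglongrightarrow> L"
    using LIMSEQ_subseq_LIMSEQ[OF L', of "\<lambda>n. 2 * n"] by (simp add: strict_mono_def o_def)
  then have "(\<lambda>n. 2 * stirling_rem n - stirling_rem (2 * n)) \<longlonglongrightarrow> 2 * L - L"
    by (intro tendsto_intros L')
  then have 1: "(\<lambda>n. 2 * stirling_rem n - stirling_rem (2 * n)) \<longlonglongrightarrow> L"
    by simp
  have "(\<lambda>n. ln ((\<Prod>k=1..n. (4 * real k ^ 2) / (4 * real k ^ 2 - 1)) * (4 + 2 / real n)) / 2)
      \<longlonglongrightarrow> ln (pi / 2 * (4 + 0)) / 2"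
    by (intro tendsto_intros wallis lim_const_over_n) auto
  moreover have "pi / 2 * (4 + 0) = 2 * pi"
    by simp
  ultimately have "(\<lambda>n. ln ((\<Prod>k=1..n. (4 * real k ^ 2) / (4 * real k ^ 2 - 1)) * (4 + 2 / real n)) / 2)
      \<longlonglongrightarrow> ln (2 * pi) / 2"
    by (simp only:)
  then have 2: "(\<lambda>n. 2 * stirling_rem n - stirling_rem (2 * n)) \<longlonglongrightarrow> ln (2 * pi) / 2"
    by (rule Lim_transform_eventually)
       (rule eventually_mono[OF eventually_ge_at_top[of 1]], simp only: two_stirling_rem_minus_double)
  show ?thesis
    using L LIMSEQ_unique[OF 1 2] by simp
qed

lemma stirling_rem_mono:
  assumes "1 \<le> m" "m \<le> n"
  shows "stirling_rem n \<le> stirling_rem m"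
  using assms(2,1) by (induction n rule: dec_induct) (auto intro: order_trans[OF stirling_rem_Suc_le])

lemma stirling_rem_ge:
  assumes "n \<ge> 1"
  shows "ln (2 * pi) / 2 \<le> stirling_rem n"
proof -
  have "decseq (\<lambda>n. stirling_rem (Suc n))"
    by (intro decseq_SucI stirling_rem_Suc_le) auto
  from decseq_ge[OF this stirling_rem_LIMSEQ, of "n - 1"] show ?thesis
    using assms by simp
qed

lemma Bernstein_at_mean_le:
  assumes "1 \<le> k" "k < n"
  shows "Bernstein n k (real k / real n) \<le> sqrt (real n / (2 * pi * real k * (real n - real k)))"
proof -
  define m where "m = n - k"
  have m: "m \<ge> 1" "n = k + m"
    using assms by (auto simp: m_def)
  have pos: "real k > 0" "real m > 0" "real n > 0"
    using assms m by auto
  let ?b = "Bernstein n k (real k / real n)"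
  have "1 - real k / real n = real m / real n"
    using pos m by (simp add: field_simps)
  then have b: "?b = fact n / (fact k * fact m) * (real k / real n) ^ k * (real m / real n) ^ m"
    using m by (simp add: Bernstein_def binomial_fact)
  then have bpos: "?b > 0"
    using pos by simp
  have "ln ?b = ln (fact n) - ln (fact k) - ln (fact m) + real k * (ln (real k) - ln (real n))
      + real m * (ln (real m) - ln (real n))"
    using pos by (simp add: b ln_mult ln_div ln_realpow)
  also have "\<dots> = stirling_rem n - stirling_rem k - stirling_rem m
      + (ln (real n) - ln (real k) - ln (real m)) / 2"
    using m(2) by (simp add: stirling_rem_def field_simps)
  also have "\<dots> \<le> (ln (real n) - ln (2 * pi) - ln (real k) - ln (real m)) / 2"
    using stirling_rem_mono[OF assms(1) less_imp_le[OF assms(2)]] stirling_rem_ge[OF m(1)]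
    unfolding diff_divide_distrib by linarith
  also have "\<dots> = ln (sqrt (real n / (2 * pi * real k * real m)))"
    using pos by (simp add: ln_sqrt ln_mult ln_div)
  finally have "?b \<le> sqrt (real n / (2 * pi * real k * real m))"
    using bpos pos by simp
  then show ?thesis
    using m by simp
qed

section \<open>Tails of the binomial distribution\<close>

definition binomial_tail :: "nat \<Rightarrow> nat \<Rightarrow> real \<Rightarrow> real" where
  "binomial_tail n k x = (\<Sum>i=k..n. Bernstein n i x)"

lemma Bernstein_eq_0: "n < k \<Longrightarrow> Bernstein n k x = 0"
  by (simp add: Bernstein_def)

text \<open>
  Conditioning on the last of \<open>n + 1\<close> trials.
\<close>

lemma Bernstein_Suc_Suc:
  "Bernstein (Suc n) (Suc k) x = x * Bernstein n k x + (1 - x) * Bernstein n (Suc k) x"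
proof (cases "k < n")
  case True
  then have "(1 - x) ^ (n - k) = (1 - x) * (1 - x) ^ (n - Suc k)"
    by (metis Suc_diff_Suc power_Suc)
  then show ?thesis
    by (simp add: Bernstein_def ring_distribs)
qed (simp add: Bernstein_def binomial_eq_0)

lemma binomial_tail_Suc_Suc:
  "binomial_tail (Suc n) (Suc k) x = x * binomial_tail n k x + (1 - x) * binomial_tail n (Suc k) x"
proof -
  have "binomial_tail (Suc n) (Suc k) x = (\<Sum>i=k..n. Bernstein (Suc n) (Suc i) x)"
    unfolding binomial_tail_def by (rule sum.shift_bounds_cl_Suc_ivl)
  also have "\<dots> = x * binomial_tail n k x + (1 - x) * (\<Sum>i=k..n. Bernstein n (Suc i) x)"
    by (simp add: Bernstein_Suc_Suc binomial_tail_def sum.distrib sum_distrib_left)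
  also have "(\<Sum>i=k..n. Bernstein n (Suc i) x) = (\<Sum>i=Suc k..Suc n. Bernstein n i x)"
    by (rule sum.shift_bounds_cl_Suc_ivl[symmetric])
  also have "\<dots> = binomial_tail n (Suc k) x"
    by (simp add: binomial_tail_def Bernstein_eq_0)
  finally show ?thesis .
qed

lemma binomial_tail_eq:
  "k \<le> n \<Longrightarrow> binomial_tail n k x = Bernstein n k x + binomial_tail n (Suc k) x"
  by (simp add: binomial_tail_def sum.atLeast_Suc_atMost)

lemma binomial_tail_0: "binomial_tail n 0 x = 1"
  by (simp add: binomial_tail_def atLeast0AtMost)

lemma binomial_tail_Suc_le:
  assumes "0 \<le> x" "x \<le> 1"
  shows "binomial_tail n (Suc k) x \<le> binomial_tail n k x"
  unfolding binomial_tail_def using assms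
  by (intro sum_mono2) (auto intro: Bernstein_nonneg)

text \<open>
  By the recursion, \<open>T(n + 1, k + 1)\<close> is the average of \<open>T(n, k) \<ge> T(n, k + 1)\<close> with weights \<open>x\<close> and
  \<open>1 - x\<close>. Raising \<open>x\<close> to \<open>y\<close> shifts weight to the larger of the two, and by induction it also
  enlarges both.
\<close>

lemma binomial_tail_mono:
  assumes "0 \<le> x" "x \<le> y" "y \<le> 1"
  shows "binomial_tail n k x \<le> binomial_tail n k y"
proof (induction n arbitrary: k)
  case 0
  then show ?case
    by (cases k) (simp_all add: binomial_tail_0, simp add: binomial_tail_def)
next
  case (Suc n)
  show ?case
  proof (cases k)
    case (Suc j)
    let ?T = "binomial_tail n"
    have "0 \<le> (y - x) * (?T j x - ?T (Suc j) x)"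
      using assms binomial_tail_Suc_le[of x n j] by (intro mult_nonneg_nonneg) auto
    then have "x * ?T j x + (1 - x) * ?T (Suc j) x \<le> y * ?T j x + (1 - y) * ?T (Suc j) x"
      by (simp add: algebra_simps)
    also have "\<dots> \<le> y * ?T j y + (1 - y) * ?T (Suc j) y"
      using assms Suc.IH by (intro add_mono mult_left_mono) auto
    finally show ?thesis
      by (simp add: Suc binomial_tail_Suc_Suc)
  qed (simp add: binomial_tail_0)
qed

section \<open>An integer mean is a median\<close>

text \<open>
  The typical use: \<open>w\<close> is increasing, \<open>D\<close> changes sign once, from plus to minus, and \<open>c\<close> is the value
  of \<open>w\<close> at the change. Then replacing \<open>w\<close> by the constant \<open>c\<close> can only increase the weighted sum.
\<close>

lemma sum_pos_of_single_crossing: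
  fixes D w :: "'i \<Rightarrow> real"
  assumes "c > 0" "\<And>j. j \<in> A \<Longrightarrow> (w j - c) * D j \<le> 0" "(\<Sum>j\<in>A. w j * D j) > 0"
  shows "(\<Sum>j\<in>A. D j) > 0"
proof -
  have "(\<Sum>j\<in>A. w j * D j) - c * (\<Sum>j\<in>A. D j) = (\<Sum>j\<in>A. (w j - c) * D j)"
    by (simp add: sum_distrib_left algebra_simps flip: sum_subtractf)
  also have "\<dots> \<le> 0"
    using assms(2) by (rule sum_nonpos)
  finally have "c * (\<Sum>j\<in>A. D j) > 0"
    using assms(3) by linarith
  then show ?thesis
    using assms(1) by (simp add: zero_less_mult_iff)
qed

lemma Bernstein_ratio:
  assumes "i < n"
  shows "real (Suc i) * (1 - x) * Bernstein n (Suc i) x = real (n - i) * x * Bernstein n i x"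
proof -
  have c: "real (Suc i) * real (n choose Suc i) = real (n - i) * real (n choose i)"
    by (metis Suc_times_binomial_eq binomial_absorb_comp mult.commute of_nat_mult binomial_absorption)
  have p: "(1 - x) ^ (n - i) = (1 - x) * (1 - x) ^ (n - Suc i)"
    using assms by (metis Suc_diff_Suc power_Suc)
  have "real (Suc i) * (1 - x) * Bernstein n (Suc i) x
      = (real (Suc i) * real (n choose Suc i)) * x * x ^ i * ((1 - x) * (1 - x) ^ (n - Suc i))"
    by (simp add: Bernstein_def)
  also have "\<dots> = real (n - i) * x * Bernstein n i x"
    unfolding c by (simp add: Bernstein_def p)
  finally show ?thesis .
qed

text \<open>
  The growth factors \<open>\<rho>\<close> stay below \<open>1\<close> once they are there, so \<open>R\<close> first rises and then falls. As
  it starts at or above \<open>1\<close>, it can go below \<open>1\<close> only on the falling part, and then it never returns.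
\<close>

lemma unimodal_ratio_single_crossing:
  fixes R \<rho> :: "nat \<Rightarrow> real"
  assumes start: "R 0 \<ge> 1" and nonneg: "\<And>j. R j \<ge> 0"
    and step: "\<And>j. Suc j < N \<Longrightarrow> R (Suc j) = R j * \<rho> j"
    and mono: "\<And>i j. i \<le> j \<Longrightarrow> Suc j < N \<Longrightarrow> \<rho> i < 1 \<Longrightarrow> \<rho> j < 1"
    and ij: "i \<le> j" "j < N" "R i < 1"
  shows "R j < 1"
proof -
  have Suc_less: "R (Suc l) < 1" if l: "Suc l < N" "R l < 1" for l
  proof (cases "\<rho> l < 1")
    case True
    have "R l * \<rho> l \<le> R l"
      using True nonneg[of l] by (intro mult_left_le) auto
    then show ?thesis
      using l step[of l] by simp
  next
    case False
    have "R l' \<ge> 1" if "l' \<le> l" for l'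
      using that
    proof (induction l')
      case (Suc l')
      then have "R l' \<ge> 1" by simp
      moreover have "\<not> \<rho> l' < 1"
        using mono[of l' l] l(1) False Suc.prems by auto
      ultimately have "R l' * \<rho> l' \<ge> 1"
        using mult_mono[of 1 "R l'" 1 "\<rho> l'"] by simp
      then show ?case
        using step[of l'] Suc.prems l(1) by simp
    qed (rule start)
    from this[of l] show ?thesis
      using l(2) by simp
  qed
  from ij(1,2) show ?thesis
  proof (induction j rule: dec_induct)
    case base
    then show ?case using ij(3) by simp
  next
    case (step l)
    then show ?case by (auto intro: Suc_less)
  qed
qed

text \<open>
  Reflection at \<open>k - 1/2\<close> pairs \<open>k + j\<close> with \<open>k - 1 - j\<close>. Letting \<open>j\<close> run up to \<open>n\<close> covers both sides
  of the reflection point, whichever is longer.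
\<close>

lemma sum_atMost_fold_at:
  fixes g :: "nat \<Rightarrow> real"
  assumes "1 \<le> k" "k \<le> n" "\<And>i. i > n \<Longrightarrow> g i = 0"
  shows "(\<Sum>i\<le>n. g i) = (\<Sum>j<n. g (k + j) + (if j < k then g (k - Suc j) else 0))"
proof -
  have "(\<Sum>j<n. g (k + j)) = (\<Sum>i=k..<k + n. g i)"
    by (simp add: sum.atLeastLessThan_shift_0[of g k "k + n"] lessThan_atLeast0 o_def add.commute)
  also have "\<dots> = (\<Sum>i=k..n. g i)"
    using assms by (intro sum.mono_neutral_right) auto
  finally have up: "(\<Sum>j<n. g (k + j)) = (\<Sum>i=k..n. g i)" .
  have "(\<Sum>j<n. if j < k then g (k - Suc j) else 0) = (\<Sum>j<k. g (k - Suc j))"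
    using assms(2) by (intro sum.mono_neutral_cong_right) auto
  also have "\<dots> = (\<Sum>i<k. g i)"
    by (rule sum.nat_diff_reindex)
  finally have dn: "(\<Sum>j<n. if j < k then g (k - Suc j) else 0) = (\<Sum>i<k. g i)" .
  have "{..n} = {..<k} \<union> {k..n}"
    using assms(2) by auto
  then have "(\<Sum>i\<le>n. g i) = (\<Sum>i<k. g i) + (\<Sum>i=k..n. g i)"
    by (simp add: sum.union_disjoint Int_def)
  then show ?thesis
    by (simp add: sum.distrib up dn)
qed

text \<open>
  With \<open>m = n - k\<close>, the quotient \<open>R j\<close> of the weights at \<open>k + j\<close> and \<open>k - 1 - j\<close> starts at
  \<open>R 0 = (m + 1) / m > 1\<close> and is multiplied by

    \<open>\<rho> j = ((m + 1)\<^sup>2 - (j + 1)\<^sup>2) k\<^sup>2 / ((k\<^sup>2 - (j + 1)\<^sup>2) m\<^sup>2)\<close>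

  in each step. Clearing denominators, \<open>\<rho> j < 1\<close> becomes
  \<open>(2 m + 1) k\<^sup>2 < (j + 1)\<^sup>2 (k\<^sup>2 - m\<^sup>2)\<close>. This persists as \<open>j\<close> grows, and it never happens if \<open>k \<le> m\<close>.
\<close>

lemma Bernstein_mean_reflection_single_crossing:
  assumes km: "1 \<le> k" "1 \<le> m"
  defines "b \<equiv> \<lambda>i. Bernstein (k + m) i (real k / real (k + m))"
  shows "b k > b (k - 1)"
    and "\<lbrakk>i \<le> j; j < k; b (k + i) < b (k - Suc i)\<rbrakk> \<Longrightarrow> b (k + j) < b (k - Suc j)"
    and "\<lbrakk>k \<le> m; j < k\<rbrakk> \<Longrightarrow> b (k - Suc j) \<le> b (k + j)"
proof -
  define n where "n = k + m"
  define x where "x = real k / real n"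
  have pos: "real k > 0" "real m > 0" "real n > 0"
    using km by (auto simp: n_def)
  have x: "0 < x" "x < 1" "x = real k / real n" "1 - x = real m / real n"
    using pos by (auto simp: x_def n_def field_simps)
  have b: "b = (\<lambda>i. Bernstein n i x)"
    by (simp add: b_def n_def x_def)
  have bpos: "b i > 0" if "i \<le> n" for i
    using that x by (simp add: b Bernstein_pos)
  have bnonneg: "b i \<ge> 0" for i
    using x by (simp add: b Bernstein_nonneg)
  have ratio: "real (Suc i) * real m * b (Suc i) = (real n - real i) * real k * b i" if "i < n" for i
  proof -
    have "(real (Suc i) * real m * b (Suc i)) / real n = ((real n - real i) * real k * b i) / real n"
      using Bernstein_ratio[OF that, of x] that unfolding x(4) b
      by (simp add: x(3) of_nat_diff del: of_nat_Suc)
    then show ?thesis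
      using pos by simp
  qed
  define R where "R j = b (k + j) / b (k - Suc j)" for j
  define \<rho> where "\<rho> j = ((real m - real j) * (real m + real j + 2) * real k ^ 2)
      / ((real k + real j + 1) * (real k - real j - 1) * real m ^ 2)" for j
  have dn_pos: "b (k - Suc j) > 0" for j
    using bpos[of "k - Suc j"] by (simp add: n_def)
  have R0: "R 0 > 1"
  proof -
    have "real k * real m * b k = (real m + 1) * real k * b (k - 1)"
      using ratio[of "k - 1"] km by (simp add: n_def of_nat_diff algebra_simps)
    then have "real m * b k = (real m + 1) * b (k - 1)"
      using pos by simp
    then have "real m * b k > real m * b (k - 1)"
      using dn_pos[of 0] by (simp add: algebra_simps)
    then show ?thesis
      using pos dn_pos[of 0] by (simp add: R_def)
  qed
  have step: "R (Suc j) = R j * \<rho> j" if j: "Suc j < k" for j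
  proof -
    have solve: "y = z * (c / a)" if "a * y = c * z" "a > 0" for a c y z :: real
      using that by (simp add: field_simps)
    have up: "b (k + Suc j) = b (k + j) * ((real m - real j) * real k / ((real k + real j + 1) * real m))"
    proof (cases "k + j < n")
      case True
      have "real k + real j + 1 > 0" by linarith
      with pos show ?thesis
        using ratio[OF True] by (intro solve) (simp_all add: n_def add.commute)
    next
      case False
      \<comment> \<open>Beyond \<open>n\<close> the weights vanish, and at \<open>k + j = n\<close> the factor \<open>m - j\<close> does.\<close>
      then have "b (k + Suc j) = 0" "b (k + j) = 0 \<or> real j = real m"
        by (auto simp: b Bernstein_eq_0 n_def)
      then show ?thesis by auto
    qed
    have kj: "real k - real j - 1 > 0"
      using j by linarith
    have "k - Suc (Suc j) < n" "Suc (k - Suc (Suc j)) = k - Suc j"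
      using j by (auto simp: n_def)
    with ratio[of "k - Suc (Suc j)"]
    have "(real k - real j - 1) * real m * b (k - Suc j)
        = (real m + real j + 2) * real k * b (k - Suc (Suc j))"
      using j by (simp add: n_def of_nat_diff algebra_simps)
    then have dn: "b (k - Suc j)
        = b (k - Suc (Suc j)) * ((real m + real j + 2) * real k / ((real k - real j - 1) * real m))"
      using kj pos by (intro solve) simp_all
    have nz: "real m + real j + 2 \<noteq> 0" "real k + real j + 1 \<noteq> 0"
      by linarith+
    show ?thesis
      unfolding R_def \<rho>_def up dn using kj nz pos dn_pos[of "Suc j"]
      by (simp add: divide_simps power2_eq_square)
  qed
  have \<rho>_less_1: "\<rho> j < 1 \<longleftrightarrow> (2 * real m + 1) * real k ^ 2 < (real j + 1) ^ 2 * (real k ^ 2 - real m ^ 2)"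
    if j: "Suc j < k" for j
  proof -
    have "real k - real j - 1 > 0" "real k + real j + 1 > 0"
      using j by linarith+
    then have "(real k + real j + 1) * (real k - real j - 1) * real m ^ 2 > 0"
      using pos by simp
    then show ?thesis
      unfolding \<rho>_def by (simp add: divide_less_eq power2_eq_square) (simp add: algebra_simps)
  qed
  have \<rho>_mono: "\<rho> j < 1" if ij: "i \<le> j" "Suc j < k" "\<rho> i < 1" for i j
  proof -
    have i: "(2 * real m + 1) * real k ^ 2 < (real i + 1) ^ 2 * (real k ^ 2 - real m ^ 2)"
      using ij \<rho>_less_1[of i] by simp
    have "0 \<le> (2 * real m + 1) * real k ^ 2"
      by simp
    with i have "0 < (real i + 1) ^ 2 * (real k ^ 2 - real m ^ 2)"
      by linarith
    then have km2: "real k ^ 2 - real m ^ 2 > 0"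
      by (simp only: zero_less_mult_iff) auto
    have "(real i + 1) ^ 2 * (real k ^ 2 - real m ^ 2) \<le> (real j + 1) ^ 2 * (real k ^ 2 - real m ^ 2)"
      using ij(1) by (intro mult_right_mono[OF power_mono less_imp_le[OF km2]]) auto
    with i show ?thesis
      using \<rho>_less_1[OF ij(2)] by linarith
  qed
  have Rnonneg: "R j \<ge> 0" for j
    by (simp add: R_def bnonneg)
  have R_less_1: "R j < 1 \<longleftrightarrow> b (k + j) < b (k - Suc j)" for j
    using dn_pos[of j] by (simp add: R_def)
  show "b k > b (k - 1)"
    using R0 dn_pos[of 0] by (simp add: R_def)
  show "b (k + j) < b (k - Suc j)" if "i \<le> j" "j < k" "b (k + i) < b (k - Suc i)"
    using unimodal_ratio_single_crossing[of R k \<rho> i j] R0 Rnonneg step \<rho>_mono that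
    by (auto simp: R_less_1)
  show "b (k - Suc j) \<le> b (k + j)" if "k \<le> m" "j < k"
  proof -
    have "R j \<ge> 1"
      using \<open>j < k\<close>
    proof (induction j)
      case (Suc j)
      have "(real j + 1) ^ 2 * (real k ^ 2 - real m ^ 2) \<le> 0"
        using \<open>k \<le> m\<close> by (intro mult_nonneg_nonpos) (auto intro!: power_mono)
      moreover have "0 \<le> (2 * real m + 1) * real k ^ 2"
        by simp
      ultimately have "\<rho> j \<ge> 1"
        using \<rho>_less_1[OF Suc.prems] by linarith
      then show ?case
        using Suc step[OF Suc.prems] mult_mono[of 1 "R j" 1 "\<rho> j"] by simp
    qed (use R0 in simp)
    then show ?thesis
      using R_less_1[of j] by linarith
  qed
qed

text \<open>
  If some \<open>D l\<close> is negative, then \<open>k > m\<close>, so the left side of the reflection is at least as long as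
  the right one: for \<open>j \<ge> k\<close>, where the lower partner \<open>k - 1 - j\<close> leaves the range, the upper partner has already left it
  and \<open>D j = 0\<close>. Hence no term after the first negative one is positive.
\<close>

theorem binomial_tail_at_mean_gt_half:
  assumes "1 \<le> k" "k < n"
  shows "binomial_tail n k (real k / real n) > 1 / 2"
proof -
  define m where "m = n - k"
  have m: "1 \<le> m" "n = k + m"
    using assms by (auto simp: m_def)
  define b where "b = (\<lambda>i. Bernstein n i (real k / real n))"
  have x: "0 \<le> real k / real n" "real k / real n \<le> 1"
    using assms by auto
  have b0: "b i = 0" if "i > n" for i
    using that by (simp add: b_def Bernstein_eq_0)
  have bnonneg: "b i \<ge> 0" for i
    using x by (simp add: b_def Bernstein_nonneg)
  have cross: "b k > b (k - 1)"
    "\<And>i j. \<lbrakk>i \<le> j; j < k; b (k + i) < b (k - Suc i)\<rbrakk> \<Longrightarrow> b (k + j) < b (k - Suc j)"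
    "\<And>j. \<lbrakk>k \<le> m; j < k\<rbrakk> \<Longrightarrow> b (k - Suc j) \<le> b (k + j)"
    using Bernstein_mean_reflection_single_crossing[OF assms(1) m(1)] unfolding m(2)[symmetric] b_def
    by blast+
  define D where "D j = b (k + j) - (if j < k then b (k - Suc j) else 0)" for j
  \<comment> \<open>\<open>w j\<close> is the distance of both \<open>k + j\<close> and \<open>k - 1 - j\<close> from the centre \<open>k - 1/2\<close>.\<close>
  define w where "w j = real j + 1 / 2" for j
  have sumb: "(\<Sum>i\<le>n. b i) = 1"
    by (simp add: b_def)
  have "(\<Sum>i\<le>n. (real i - real k + 1 / 2) * b i)
      = (\<Sum>i\<le>n. real i * b i - (real k - 1 / 2) * b i)"
    by (intro sum.cong) (simp_all add: algebra_simps)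
  also have "\<dots> = (\<Sum>i\<le>n. real i * b i) - (real k - 1 / 2) * (\<Sum>i\<le>n. b i)"
    by (subst sum_subtractf) (simp only: sum_distrib_left)
  also have "\<dots> = 1 / 2"
    using assms by (simp add: b_def)
  finally have mean: "(\<Sum>i\<le>n. (real i - real k + 1 / 2) * b i) = 1 / 2" .
  have "(\<Sum>j<n. w j * D j) = (\<Sum>i\<le>n. (real i - real k + 1 / 2) * b i)"
  proof -
    define g where "g i = (real i - real k + 1 / 2) * b i" for i
    have "w j * D j = g (k + j) + (if j < k then g (k - Suc j) else 0)" for j
    proof (cases "j < k")
      case True
      then have "real (k - Suc j) = real k - real j - 1"
        by (simp add: of_nat_diff)
      with True show ?thesis
        by (simp add: w_def D_def g_def right_diff_distrib) (simp add: ring_distribs)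
    qed (simp add: w_def D_def g_def)
    moreover have "sum g {..n} = (\<Sum>j<n. g (k + j) + (if j < k then g (k - Suc j) else 0))"
      using assms b0 by (intro sum_atMost_fold_at) (auto simp: g_def)
    ultimately show ?thesis
      by (simp add: g_def)
  qed
  with mean have wD: "(\<Sum>j<n. w j * D j) > 0"
    by simp
  have "(\<Sum>j<n. D j) > 0"
  proof (cases "\<forall>j<n. D j \<ge> 0")
    case True
    have "D 0 > 0"
      using cross(1) assms(1) by (simp add: D_def)
    then show ?thesis
      using True assms by (intro sum_pos2[of _ 0]) auto
  next
    case False
    then obtain j where j: "D j < 0"
      by (meson not_le)
    define l where "l = (LEAST j. D j < 0)"
    have l: "D l < 0"
      unfolding l_def using j by (rule LeastI)
    have before: "D j \<ge> 0" if "j < l" for j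
      using not_less_Least[of j "\<lambda>j. D j < 0"] that unfolding l_def by simp
    have "l < k"
      using l bnonneg[of "k + l"] by (auto simp: D_def split: if_splits)
    have "m < k"
      using cross(3)[of l] l \<open>l < k\<close> by (cases "m < k") (auto simp: D_def)
    have after: "D j \<le> 0" if "j \<ge> l" for j
    proof (cases "j < k")
      case True
      then show ?thesis
        using cross(2)[OF that True] l \<open>l < k\<close> by (simp add: D_def)
    next
      case False
      then show ?thesis
        using b0[of "k + j"] \<open>m < k\<close> m by (simp add: D_def)
    qed
    show ?thesis
    proof (rule sum_pos_of_single_crossing[where w = w and c = "w l"])
      show "(w j - w l) * D j \<le> 0" for j
        using before[of j] after[of j]
        by (cases "j < l") (auto simp: w_def intro: mult_nonneg_nonpos mult_nonpos_nonneg)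
    qed (use wD in \<open>auto simp: w_def\<close>)
  qed
  also have "(\<Sum>j<n. D j) = (\<Sum>i\<le>n. if i < k then - b i else b i)"
  proof -
    define g where "g i = (if i < k then - b i else b i)" for i
    have "D j = g (k + j) + (if j < k then g (k - Suc j) else 0)" for j
      using assms(1) by (simp add: D_def g_def)
    moreover have "sum g {..n} = (\<Sum>j<n. g (k + j) + (if j < k then g (k - Suc j) else 0))"
      using assms b0 by (intro sum_atMost_fold_at) (auto simp: g_def)
    ultimately show ?thesis
      by (simp add: g_def)
  qed
  also have "\<dots> = (\<Sum>i\<le>n. (if k \<le> i then 2 * b i else 0) - b i)"
    by (intro sum.cong) auto
  also have "\<dots> = (\<Sum>i\<le>n. if k \<le> i then 2 * b i else 0) - 1"
    by (simp add: sum_subtractf sumb)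
  also have "(\<Sum>i\<le>n. if k \<le> i then 2 * b i else 0) = (\<Sum>i=k..n. 2 * b i)"
    by (intro sum.mono_neutral_cong_right) auto
  also have "\<dots> = 2 * binomial_tail n k (real k / real n)"
    by (simp add: binomial_tail_def b_def sum_distrib_left)
  finally show ?thesis
    by simp
qed

section \<open>Binomially distributed random variables\<close>

text \<open>
  The prescribed point probabilities already add up to \<open>1\<close>, which leaves no mass elsewhere.
\<close>

lemma (in prob_space) binomially_distributed_AE:
  assumes "binomially_distributed M X n p"
  shows "AE \<omega> in M. X \<omega> \<in> real ` {..n}"
proof -
  have [measurable]: "X \<in> borel_measurable M"
    and eq: "\<And>i. i \<le> n \<Longrightarrow> prob {\<omega> \<in> space M. X \<omega> = real i} = Bernstein n i p"
    using assms by (auto simp: binomially_distributed_def Bernstein_def)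
  have "prob (\<Union>i\<le>n. {\<omega> \<in> space M. X \<omega> = real i}) = (\<Sum>i\<le>n. prob {\<omega> \<in> space M. X \<omega> = real i})"
    by (intro finite_measure_finite_Union) (auto simp: disjoint_family_on_def)
  also have "\<dots> = 1"
    by (simp add: eq)
  finally have "AE \<omega> in M. \<omega> \<in> (\<Union>i\<le>n. {\<omega> \<in> space M. X \<omega> = real i})"
    by (subst (asm) prob_eq_1) auto
  then show ?thesis
    by eventually_elim auto
qed

lemma (in prob_space) expectation_binomially_distributed:
  assumes "binomially_distributed M X n p"
  shows "expectation X = real n * p"
proof -
  have X[measurable]: "X \<in> borel_measurable M"
    and eq: "\<And>i. i \<le> n \<Longrightarrow> prob {\<omega> \<in> space M. X \<omega> = real i} = Bernstein n i p"
    using assms by (auto simp: binomially_distributed_def Bernstein_def)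
  let ?A = "\<lambda>i. {\<omega> \<in> space M. X \<omega> = real i}"
  have "expectation X = expectation (\<lambda>\<omega>. \<Sum>i\<le>n. real i * indicator (?A i) \<omega>)"
  proof (rule integral_cong_AE)
    show "AE \<omega> in M. X \<omega> = (\<Sum>i\<le>n. real i * indicator (?A i) \<omega>)"
      using binomially_distributed_AE[OF assms] AE_space
    proof eventually_elim
      case (elim \<omega>)
      then obtain i where i: "i \<le> n" "X \<omega> = real i"
        by auto
      have "(\<Sum>j\<le>n. real j * indicator (?A j) \<omega>) = (\<Sum>j\<le>n. if j = i then real i else 0)"
        using i elim by (intro sum.cong) (auto simp: indicator_def)
      then show ?case
        using i by simp
    qed
    show "(\<lambda>\<omega>. \<Sum>i\<le>n. real i * indicator (?A i) \<omega>) \<in> borel_measurable M"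
      by measurable
  qed (rule X)
  also have "\<dots> = (\<Sum>i\<le>n. real i * prob (?A i))"
    by (subst Bochner_Integration.integral_sum) (auto simp: emeasure_eq_measure)
  also have "\<dots> = real n * p"
    by (simp add: eq)
  finally show ?thesis .
qed

lemma (in prob_space) binomial_tail_le_prob_greater:
  assumes "binomially_distributed M X n p" "c < real k"
  shows "binomial_tail n k p \<le> \<P>(\<omega> in M. X \<omega> > c)"
proof -
  have [measurable]: "X \<in> borel_measurable M"
    and eq: "\<And>i. i \<le> n \<Longrightarrow> prob {\<omega> \<in> space M. X \<omega> = real i} = Bernstein n i p"
    using assms(1) by (auto simp: binomially_distributed_def Bernstein_def)
  have "binomial_tail n k p = (\<Sum>i=k..n. prob {\<omega> \<in> space M. X \<omega> = real i})"
    by (simp add: eq binomial_tail_def)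
  also have "\<dots> = prob (\<Union>i\<in>{k..n}. {\<omega> \<in> space M. X \<omega> = real i})"
    by (intro finite_measure_finite_Union[symmetric]) (auto simp: disjoint_family_on_def)
  also have "\<dots> \<le> \<P>(\<omega> in M. X \<omega> > c)"
    using assms(2) by (intro finite_measure_mono) auto
  finally show ?thesis .
qed

theorem lemma8:
  fixes M :: "'a measure" and X :: "'a \<Rightarrow> real" and n :: nat and p :: real and k :: int
  assumes "prob_space M"
    and "n \<ge> 1"
    and "1 / real n \<le> p" and "p < 1"
    and "binomially_distributed M X n p"
    and "k = \<lfloor>real n * p\<rfloor>"
  shows "\<P>(\<omega> in M. X \<omega> > prob_space.expectation M X)
           > 1 / 2 - sqrt (real n / (2 * pi * real_of_int k * (real n - real_of_int k)))"
proof -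
  interpret prob_space M by fact
  have n: "real n > 0"
    using assms(2) by simp
  have np: "1 \<le> real n * p" "real n * p < real n"
    using assms(3,4) n by (auto simp: field_simps)
  define K where "K = nat k"
  have "1 \<le> k"
    using np(1) assms(6) by simp
  then have K: "real K = real_of_int k" "1 \<le> K"
    by (auto simp: K_def)
  have fl: "real K \<le> real n * p" "real n * p < real (Suc K)"
    unfolding of_nat_Suc K assms(6) by linarith+
  have Kn: "K < n"
    using fl(1) np(2) by linarith
  let ?x = "real K / real n"
  have x: "0 \<le> ?x" "?x \<le> p"
    using fl(1) n by (auto simp: field_simps)
  have "1 / 2 - sqrt (real n / (2 * pi * real K * (real n - real K))) < binomial_tail n K ?x - Bernstein n K ?x"
    using binomial_tail_at_mean_gt_half[OF K(2) Kn] Bernstein_at_mean_le[OF K(2) Kn] by linarith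
  also have "\<dots> = binomial_tail n (Suc K) ?x"
    using Kn by (simp add: binomial_tail_eq)
  also have "\<dots> \<le> binomial_tail n (Suc K) p"
    using x assms(4) by (intro binomial_tail_mono) auto
  also have "\<dots> \<le> \<P>(\<omega> in M. X \<omega> > real n * p)"
    using assms(5) fl(2) by (rule binomial_tail_le_prob_greater)
  finally show ?thesis
    unfolding expectation_binomially_distributed[OF assms(5)] K .
qed

end
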